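(* Let $m\geq 2$ and let $\alpha_m$ be the unique real number $\alpha>1$ with $f_m(\alpha)=1$, where $f_m(\alpha) = (\alpha-1)(H_{m-1}-H_{\lceil(1-1/\alpha)m\rceil-1}) + \lceil(1-1/\alpha)m\rceil\, \alpha/m$. Let $A$ be any deterministic online algorithm for makespan minimization on $m$ identical machines with job migration such that, for some function $g$ with $g(n)=o(n)$, $A$ performs at most $g(n)$ job migrations on every job sequence of length $n$. Then $A$ is not $c$-competitive for any $c<\alpha_m$; i.e., for every $c<\alpha_m$ there is a job sequence $\sigma$ for which the makespan of $A$'s final schedule exceeds $c\cdot\mathrm{OPT}(\sigma)$.
   Context: Problem: a sequence of jobs with positive processing times arrives online and must be scheduled non-preemptively on $m$ identical machines; each job is assigned to a machine immediately upon arrival without knowledge of future jobs. At any time the algorithm may migrate jobs, i.e. remove an already assigned job from its machine and reassign it to another machine; each such reassignment counts as one migration. The makespan is the maximum machine load (sum of processing times of the jobs on it) in the final schedule. $\mathrm{OPT}(\sigma)$ is the optimum offline non-preemptive makespan for $\sigma$. An algorithm is $c$-competitive if on every job sequence its makespan is at most $c\cdot\mathrm{OPT}$. $H_k=\sum_{i=1}^k1/i$, $H_0=0$. *)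

theory Defs
  imports "HOL-Analysis.Harmonic_Numbers" "HOL-Library.Landau_Symbols"
begin

section \<open>Scheduling on identical machines\<close>

text \<open>
  A job sequence is the list of its processing times. Jobs are numbered
  \<open>0, ..., n - 1\<close> in order of arrival, machines \<open>0, ..., m - 1\<close>; a schedule
  of \<open>n\<close> jobs is a list of length \<open>n\<close> whose entry \<open>j\<close> is the machine of job \<open>j\<close>.
\<close>

definition job_sequence :: "real list \<Rightarrow> bool" where
  "job_sequence \<sigma> \<longleftrightarrow> (\<forall>p\<in>set \<sigma>. p > 0)"

definition schedules :: "nat \<Rightarrow> real list \<Rightarrow> nat list set" where
  "schedules m \<sigma> = {s. length s = length \<sigma> \<and> set s \<subseteq> {..<m}}"

definition load :: "real list \<Rightarrow> nat list \<Rightarrow> nat \<Rightarrow> real" where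
  "load \<sigma> s i = (\<Sum>j\<in>{j. j < length \<sigma> \<and> s ! j = i}. \<sigma> ! j)"

definition makespan :: "nat \<Rightarrow> real list \<Rightarrow> nat list \<Rightarrow> real" where
  "makespan m \<sigma> s = Max (load \<sigma> s ` {..<m})"

definition OPT :: "nat \<Rightarrow> real list \<Rightarrow> real" where
  "OPT m \<sigma> = Min (makespan m \<sigma> ` schedules m \<sigma>)"

section \<open>Deterministic online algorithms with job migration\<close>

text \<open>
  Being deterministic, an online algorithm bases its decisions on the jobs seen so far.
  On arrival of the last job of \<open>\<sigma>\<close> it assigns this job to machine \<open>place A \<sigma>\<close> and then
  performs the migrations \<open>migrations A \<sigma>\<close>, in this order. (Migrations made between arrival
  and assignment concern the other jobs only, so they can equally be performed afterwards.)
  A migration \<open>(j, i)\<close> moves job \<open>j\<close> to machine \<open>i\<close>. Since migrations are allowed at any time,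
  they are also allowed after the whole sequence has arrived; \<open>final_migrations A \<sigma>\<close> are those
  performed if \<open>\<sigma>\<close> turns out to be the entire input. They have no effect on what happens
  on proper extensions of \<open>\<sigma>\<close>. Algorithms that are not told when the input ends are those with
  \<open>final_migrations A \<sigma> = []\<close>.
\<close>

record online_algorithm =
  place :: "real list \<Rightarrow> nat"
  migrations :: "real list \<Rightarrow> (nat \<times> nat) list"
  final_migrations :: "real list \<Rightarrow> (nat \<times> nat) list"

fun migrate :: "(nat \<times> nat) list \<Rightarrow> nat list \<Rightarrow> nat list" where
  "migrate [] s = s"
| "migrate ((j, i) # ms) s = migrate ms (s[j := i])"

fun valid_migrations :: "nat \<Rightarrow> (nat \<times> nat) list \<Rightarrow> nat list \<Rightarrow> bool" where
  "valid_migrations m [] s \<longleftrightarrow> True"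
| "valid_migrations m ((j, i) # ms) s \<longleftrightarrow>
     j < length s \<and> i < m \<and> i \<noteq> s ! j \<and> valid_migrations m ms (s[j := i])"

text \<open>The schedule when the first \<open>k\<close> jobs of \<open>\<sigma>\<close> have been processed.\<close>

primrec online_schedule :: "online_algorithm \<Rightarrow> real list \<Rightarrow> nat \<Rightarrow> nat list" where
  "online_schedule A \<sigma> 0 = []"
| "online_schedule A \<sigma> (Suc k) =
     migrate (migrations A (take (Suc k) \<sigma>))
       (online_schedule A \<sigma> k @ [place A (take (Suc k) \<sigma>)])"

definition final_schedule :: "online_algorithm \<Rightarrow> real list \<Rightarrow> nat list" where
  "final_schedule A \<sigma> = migrate (final_migrations A \<sigma>) (online_schedule A \<sigma> (length \<sigma>))"

definition valid_algorithm :: "nat \<Rightarrow> online_algorithm \<Rightarrow> bool" where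
  "valid_algorithm m A \<longleftrightarrow> (\<forall>\<sigma>. job_sequence \<sigma> \<longrightarrow>
     (\<forall>k<length \<sigma>.
        place A (take (Suc k) \<sigma>) < m \<and>
        valid_migrations m (migrations A (take (Suc k) \<sigma>))
          (online_schedule A \<sigma> k @ [place A (take (Suc k) \<sigma>)])) \<and>
     valid_migrations m (final_migrations A \<sigma>) (online_schedule A \<sigma> (length \<sigma>)))"

definition num_migrations :: "online_algorithm \<Rightarrow> real list \<Rightarrow> nat" where
  "num_migrations A \<sigma> =
     (\<Sum>k<length \<sigma>. length (migrations A (take (Suc k) \<sigma>))) + length (final_migrations A \<sigma>)"

definition competitive :: "nat \<Rightarrow> real \<Rightarrow> online_algorithm \<Rightarrow> bool" where
  "competitive m c A \<longleftrightarrow>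
     (\<forall>\<sigma>. job_sequence \<sigma> \<longrightarrow> makespan m \<sigma> (final_schedule A \<sigma>) \<le> c * OPT m \<sigma>)"

section \<open>The critical ratio\<close>

text \<open>For \<open>\<alpha> > 1\<close> and \<open>m > 0\<close> the ceiling is positive, so no truncation occurs.\<close>

definition critical_fun :: "nat \<Rightarrow> real \<Rightarrow> real" where
  "critical_fun m \<alpha> = (let k = nat \<lceil>(1 - 1 / \<alpha>) * real m\<rceil> in
     (\<alpha> - 1) * (harm (m - 1) - harm (k - 1)) + real k * \<alpha> / real m)"

definition critical_ratio :: "nat \<Rightarrow> real" where
  "critical_ratio m = (THE \<alpha>. \<alpha> > 1 \<and> critical_fun m \<alpha> = 1)"

text \<open>Existence and uniqueness, so that the definite description is meaningful.\<close>

lemma critical_fun_eq_sum_min: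
  assumes "m \<ge> 1" "\<alpha> > 1"
  shows "critical_fun m \<alpha> = (\<Sum>i=1..m-1. min (\<alpha> / real m) ((\<alpha> - 1) / real i)) + \<alpha> / real m"
proof -
  define k where "k = nat \<lceil>(1 - 1 / \<alpha>) * real m\<rceil>"
  have pos: "0 < (1 - 1 / \<alpha>) * real m" using assms by simp
  have lt: "(1 - 1 / \<alpha>) * real m < real m" using assms by (simp add: field_simps)
  have k1: "k \<ge> 1" using pos unfolding k_def by linarith
  have km: "k \<le> m" using lt unfolding k_def by linarith
  have below: "real i < (1 - 1 / \<alpha>) * real m" if "i < k" for i
    using that unfolding k_def by linarith
  have above: "(1 - 1 / \<alpha>) * real m \<le> real i" if "k \<le> i" for i
    using that unfolding k_def by linarith
  have split: "{1..m-1} = {1..k-1} \<union> {k..m-1}" using k1 km by auto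
  have disj: "{1..k-1} \<inter> {k..m-1} = {}" using k1 by auto
  have A: "(\<Sum>i=1..k-1. min (\<alpha> / real m) ((\<alpha> - 1) / real i)) = (\<Sum>i=1..k-1. \<alpha> / real m)"
  proof (rule sum.cong)
    fix i assume i: "i \<in> {1..k-1}"
    then have "real i < (1 - 1 / \<alpha>) * real m" by (intro below) (use k1 in auto)
    then have "\<alpha> / real m \<le> (\<alpha> - 1) / real i" using assms i by (simp add: field_simps)
    then show "min (\<alpha> / real m) ((\<alpha> - 1) / real i) = \<alpha> / real m" by simp
  qed simp
  have B: "(\<Sum>i=k..m-1. min (\<alpha> / real m) ((\<alpha> - 1) / real i)) =
      (\<Sum>i=k..m-1. (\<alpha> - 1) * inverse (real i))"
  proof (rule sum.cong)
    fix i assume i: "i \<in> {k..m-1}"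
    then have "(1 - 1 / \<alpha>) * real m \<le> real i" by (intro above) auto
    then have "(\<alpha> - 1) / real i \<le> \<alpha> / real m" using assms i k1 by (simp add: field_simps)
    then show "min (\<alpha> / real m) ((\<alpha> - 1) / real i) = (\<alpha> - 1) * inverse (real i)"
      by (simp add: divide_inverse)
  qed simp
  have H: "harm (m - 1) = harm (k - 1) + (\<Sum>i=k..m-1. inverse (real i))"
    unfolding harm_def split by (subst sum.union_disjoint) (use disj in auto)
  have "(\<Sum>i=1..m-1. min (\<alpha> / real m) ((\<alpha> - 1) / real i)) =
      real (k - 1) * (\<alpha> / real m) + (\<alpha> - 1) * (harm (m - 1) - harm (k - 1))"
    unfolding split by (subst sum.union_disjoint) (use disj A B H in \<open>auto simp: sum_distrib_left\<close>)
  moreover have "real k * \<alpha> / real m = real (k - 1) * (\<alpha> / real m) + \<alpha> / real m"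
    using k1 by (simp add: of_nat_diff left_diff_distrib diff_divide_distrib)
  ultimately show ?thesis
    unfolding critical_fun_def Let_def k_def[symmetric] by simp
qed

lemma ex1_critical_ratio:
  assumes "m \<ge> 2"
  shows "\<exists>!\<alpha>. \<alpha> > 1 \<and> critical_fun m \<alpha> = 1"
proof -
  define h where
    "h \<alpha> = (\<Sum>i=1..m-1. min (\<alpha> / real m) ((\<alpha> - 1) / real i)) + \<alpha> / real m" for \<alpha> :: real
  have fh: "critical_fun m \<alpha> = h \<alpha>" if "\<alpha> > 1" for \<alpha>
    using critical_fun_eq_sum_min[of m \<alpha>] that assms by (simp add: h_def)
  have mono: "h x < h y" if "x < y" for x y
    unfolding h_def
    by (intro add_le_less_mono sum_mono min.mono divide_right_mono divide_strict_right_mono)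
       (use that assms in auto)
  have cont: "continuous_on {1..real m} h"
    unfolding h_def by (intro continuous_intros) auto
  have "(\<Sum>i=1..m-1. min (1 / real m) ((1 - 1) / real i)) = 0"
    by (intro sum.neutral) auto
  then have h1: "h 1 < 1" using assms by (simp add: h_def)
  have "0 \<le> (\<Sum>i=1..m-1. min (real m / real m) ((real m - 1) / real i))"
    by (intro sum_nonneg) (use assms in auto)
  then have hm: "1 \<le> h (real m)" using assms by (simp add: h_def)
  obtain a where a: "1 \<le> a" "a \<le> real m" "h a = 1"
    using IVT'[of h 1 1 "real m"] h1 hm cont assms by auto
  have "a > 1" using a h1 by (cases "a = 1") auto
  show ?thesis
  proof (rule ex1I[of _ a])
    show "a > 1 \<and> critical_fun m a = 1" using \<open>a > 1\<close> a fh by simp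
    show "b = a" if "b > 1 \<and> critical_fun m b = 1" for b
      using that a fh mono[of a b] mono[of b a] by (cases a b rule: linorder_cases) auto
  qed
qed

lemma critical_ratio:
  assumes "m \<ge> 2"
  shows "critical_ratio m > 1" "critical_fun m (critical_ratio m) = 1"
  using theI'[OF ex1_critical_ratio[OF assms]] unfolding critical_ratio_def by auto

end

theory Submission imports Defs begin

text \<open>
  The adversary presents \<open>n\<close> unit jobs. Since \<open>c\<close> is below the critical ratio, the thresholds
  \<open>min (c / m) ((c - 1) / i)\<close> (\<open>c / m\<close> for \<open>i = 0\<close>), \<open>i < m\<close>, sum to less than \<open>1\<close>, so for some \<open>i\<close> more than \<open>i\<close> machines
  carry more than \<open>n\<close> times the \<open>i\<close>-th threshold. If this threshold is \<open>c / m\<close>, the input ends.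
  Otherwise \<open>m - i\<close> jobs of size \<open>n / i\<close> follow, keeping the optimum at \<open>n / i\<close>; then either
  two of them share a machine, or one of them is on a machine that carried more than
  \<open>(c - 1) * n / i\<close>. Each migration shifts at most one unit job, so \<open>o(n)\<close> migrations are
  absorbed by the slack in the thresholds.
\<close>

section \<open>Schedules produced by an online algorithm\<close>

lemma length_migrate [simp]: "length (migrate ms s) = length s"
  by (induction ms s rule: migrate.induct) auto

lemma length_online_schedule [simp]: "length (online_schedule A \<sigma> k) = k"
  by (induction k) auto

lemma length_final_schedule [simp]: "length (final_schedule A \<sigma>) = length \<sigma>"
  by (simp add: final_schedule_def)

lemma set_migrate:
  "valid_migrations m ms s \<Longrightarrow> set s \<subseteq> {..<m} \<Longrightarrow> set (migrate ms s) \<subseteq> {..<m}"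
proof (induction ms s rule: migrate.induct)
  case (2 j i ms s)
  have "set (s[j := i]) \<subseteq> insert i (set s)" by (rule set_update_subset_insert)
  with 2 show ?case by auto
qed simp

lemma set_online_schedule:
  assumes "valid_algorithm m A" "job_sequence \<sigma>" "k \<le> length \<sigma>"
  shows "set (online_schedule A \<sigma> k) \<subseteq> {..<m}"
  using assms(3)
proof (induction k)
  case (Suc k)
  then have "place A (take (Suc k) \<sigma>) < m"
    "valid_migrations m (migrations A (take (Suc k) \<sigma>))
       (online_schedule A \<sigma> k @ [place A (take (Suc k) \<sigma>)])"
    using assms(1,2) unfolding valid_algorithm_def by auto
  with Suc show ?case using set_migrate by simp
qed simp

lemma final_schedule_in_schedules:
  assumes "valid_algorithm m A" "job_sequence \<sigma>"
  shows "final_schedule A \<sigma> \<in> schedules m \<sigma>"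
proof -
  have "set (final_schedule A \<sigma>) \<subseteq> {..<m}"
    unfolding final_schedule_def
    using assms set_online_schedule[OF assms order_refl]
    by (intro set_migrate) (auto simp: valid_algorithm_def)
  then show ?thesis by (simp add: schedules_def)
qed

text \<open>Decisions depend only on the prefix seen so far, which allows the adversary to choose
  \<open>\<tau>\<close> after inspecting the schedule of \<open>\<sigma>\<close>.\<close>

lemma online_schedule_append:
  "k \<le> length \<sigma> \<Longrightarrow> online_schedule A (\<sigma> @ \<tau>) k = online_schedule A \<sigma> k"
  by (induction k) auto

section \<open>Unit jobs per machine under migrations\<close>

definition num_on :: "nat \<Rightarrow> nat list \<Rightarrow> nat \<Rightarrow> nat" where
  "num_on n s i = card {j. j < n \<and> s ! j = i}"

text \<open>Since only the first \<open>n\<close> jobs are counted, \<open>num_on\<close> can follow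
  the unit jobs through schedules that also hold later jobs.\<close>

lemma num_on_append: "n \<le> length s \<Longrightarrow> num_on n (s @ t) i = num_on n s i"
  unfolding num_on_def by (intro arg_cong[where f = card]) (auto simp: nth_append)

lemma sum_num_on:
  assumes "length s = n" "set s \<subseteq> {..<m}"
  shows "(\<Sum>i<m. num_on n s i) = n"
proof -
  have "(\<Sum>i<m. num_on n s i) = card (\<Union>i<m. {j. j < n \<and> s ! j = i})"
    unfolding num_on_def by (rule card_UN_disjoint[symmetric]) auto
  also have "(\<Union>i<m. {j. j < n \<and> s ! j = i}) = {..<n}"
    using assms by (fastforce dest: nth_mem)
  finally show ?thesis by simp
qed

lemma num_on_migrate: "num_on n s i \<le> num_on n (migrate ms s) i + length ms"
proof (induction ms s rule: migrate.induct)
  case (2 j k ms s)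
  have "num_on n s i \<le> card (insert j {l. l < n \<and> s[j := k] ! l = i})"
    unfolding num_on_def by (rule card_mono) (auto simp: nth_list_update)
  also have "\<dots> \<le> Suc (num_on n (s[j := k]) i)"
    unfolding num_on_def by (rule card_insert_le_m1) auto
  finally show ?case using 2 by simp
qed simp

lemma num_on_online_schedule:
  assumes "n \<le> k"
  shows "num_on n (online_schedule A \<sigma> n) i \<le> num_on n (online_schedule A \<sigma> k) i
    + (\<Sum>l\<in>{n..<k}. length (migrations A (take (Suc l) \<sigma>)))"
  using assms
proof (induction k rule: dec_induct)
  case (step k)
  have "num_on n (online_schedule A \<sigma> k) i \<le>
      num_on n (online_schedule A \<sigma> (Suc k)) i + length (migrations A (take (Suc k) \<sigma>))"
    using num_on_migrate[of n "online_schedule A \<sigma> k @ [place A (take (Suc k) \<sigma>)]" i]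
    by (simp add: num_on_append step.hyps)
  with step show ?case by simp
qed simp

lemma num_on_final_schedule:
  "num_on (length \<sigma>) (online_schedule A \<sigma> (length \<sigma>)) i \<le>
     num_on (length \<sigma>) (final_schedule A (\<sigma> @ \<tau>)) i + num_migrations A (\<sigma> @ \<tau>)"
proof -
  let ?n = "length \<sigma>" and ?k = "length (\<sigma> @ \<tau>)"
  let ?f = "\<lambda>l. length (migrations A (take (Suc l) (\<sigma> @ \<tau>)))"
  have "num_on ?n (online_schedule A \<sigma> ?n) i = num_on ?n (online_schedule A (\<sigma> @ \<tau>) ?n) i"
    by (simp add: online_schedule_append)
  also have "\<dots> \<le> num_on ?n (online_schedule A (\<sigma> @ \<tau>) ?k) i + sum ?f {?n..<?k}"
    by (rule num_on_online_schedule) simp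
  \<comment> \<open>Migrations made while \<open>\<sigma>\<close> was arriving are counted too; this
    loss is harmless, as a sublinear bound on the total number is available.\<close>
  also have "sum ?f {?n..<?k} \<le> sum ?f {..<?k}"
    by (rule sum_mono2) auto
  also have "num_on ?n (online_schedule A (\<sigma> @ \<tau>) ?k) i \<le>
      num_on ?n (final_schedule A (\<sigma> @ \<tau>)) i + length (final_migrations A (\<sigma> @ \<tau>))"
    unfolding final_schedule_def by (rule num_on_migrate)
  finally show ?thesis by (simp add: num_migrations_def)
qed

section \<open>Makespan and optimum\<close>

lemma finite_schedules: "finite (schedules m \<sigma>)"
  using finite_lists_length_eq[of "{..<m}" "length \<sigma>"]
  by (rule finite_subset[rotated]) (auto simp: schedules_def)

lemma OPT_le: "s \<in> schedules m \<sigma> \<Longrightarrow> OPT m \<sigma> \<le> makespan m \<sigma> s"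
  unfolding OPT_def by (intro Min_le) (auto simp: finite_schedules)

lemma load_le_makespan: "i < m \<Longrightarrow> load \<sigma> s i \<le> makespan m \<sigma> s"
  unfolding makespan_def by (intro Max_ge) auto

lemma makespan_le: "m > 0 \<Longrightarrow> (\<And>i. i < m \<Longrightarrow> load \<sigma> s i \<le> B) \<Longrightarrow> makespan m \<sigma> s \<le> B"
  unfolding makespan_def by (subst Max_le_iff) auto

lemma load_nonneg: "job_sequence \<sigma> \<Longrightarrow> 0 \<le> load \<sigma> s i"
  unfolding load_def job_sequence_def by (intro sum_nonneg) (auto intro: less_imp_le)

lemma OPT_nonneg:
  assumes "m > 0" "job_sequence \<sigma>"
  shows "0 \<le> OPT m \<sigma>"
proof -
  \<comment> \<open>Putting all jobs on machine 0 shows that the \<open>Min\<close> ranges over a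
    nonempty set.\<close>
  have "replicate (length \<sigma>) 0 \<in> schedules m \<sigma>" using assms by (auto simp: schedules_def)
  then have "OPT m \<sigma> \<in> makespan m \<sigma> ` schedules m \<sigma>"
    unfolding OPT_def by (intro Min_in) (auto simp: finite_schedules)
  then show ?thesis
    using load_le_makespan[OF assms(1)] load_nonneg[OF assms(2)] by (fastforce intro: order_trans)
qed

text \<open>The optimum is nonnegative. This permits raising the ratio above 1 in the main
  argument.\<close>

lemma competitive_mono:
  assumes "m > 0" "competitive m c A" "c \<le> c'"
  shows "competitive m c' A"
  unfolding competitive_def
proof (intro allI impI)
  fix \<sigma> assume \<sigma>: "job_sequence \<sigma>"
  have "makespan m \<sigma> (final_schedule A \<sigma>) \<le> c * OPT m \<sigma>"
    using assms(2) \<sigma> by (auto simp: competitive_def)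
  also have "\<dots> \<le> c' * OPT m \<sigma>"
    by (intro mult_right_mono OPT_nonneg assms \<sigma>)
  finally show "makespan m \<sigma> (final_schedule A \<sigma>) \<le> c' * OPT m \<sigma>" .
qed

section \<open>Unit jobs followed by large jobs\<close>

lemma load_replicate_append:
  "load (replicate n 1 @ replicate b p) s i =
     real (num_on n s i) + p * real (card {j \<in> {n..<n+b}. s ! j = i})"
proof -
  let ?\<sigma> = "replicate n 1 @ replicate b p"
  have split: "{j. j < length ?\<sigma> \<and> s ! j = i} = {j. j < n \<and> s ! j = i} \<union> {j \<in> {n..<n+b}. s ! j = i}"
    by auto
  have disj: "{j. j < n \<and> s ! j = i} \<inter> {j \<in> {n..<n+b}. s ! j = i} = {}"
    by auto
  have "load ?\<sigma> s i =
      (\<Sum>j | j < n \<and> s ! j = i. ?\<sigma> ! j) + (\<Sum>j \<in> {j \<in> {n..<n+b}. s ! j = i}. ?\<sigma> ! j)"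
    unfolding load_def split by (rule sum.union_disjoint[OF _ _ disj]) auto
  also have "(\<Sum>j | j < n \<and> s ! j = i. ?\<sigma> ! j) = (\<Sum>j | j < n \<and> s ! j = i. 1)"
    by (intro sum.cong) (auto simp: nth_append)
  also have "(\<Sum>j \<in> {j \<in> {n..<n+b}. s ! j = i}. ?\<sigma> ! j) = (\<Sum>j \<in> {j \<in> {n..<n+b}. s ! j = i}. p)"
    by (intro sum.cong) (auto simp: nth_append)
  finally show ?thesis by (simp add: num_on_def)
qed

lemma card_mod_eq_le: "card {j. j < d * q \<and> j mod d = i} \<le> (q::nat)"
proof -
  have "{j. j < d * q \<and> j mod d = i} \<subseteq> (\<lambda>k. d * k + i) ` {..<q}"
  proof
    fix j assume "j \<in> {j. j < d * q \<and> j mod d = i}"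
    then have "j = d * (j div d) + i" "j div d < q"
      by (auto simp: less_mult_imp_div_less mult.commute)
    then show "j \<in> (\<lambda>k. d * k + i) ` {..<q}" by blast
  qed
  then have "card {j. j < d * q \<and> j mod d = i} \<le> card ((\<lambda>k. d * k + i) ` {..<q})"
    by (intro card_mono) auto
  also have "\<dots> \<le> q" using card_image_le[of "{..<q}"] by simp
  finally show ?thesis .
qed

text \<open>Round robin puts \<open>q\<close> unit jobs on each of the first \<open>d\<close>
  machines, and each remaining machine takes one job of size \<open>q\<close>. For
  \<open>d = m\<close> there are no large jobs.\<close>

lemma OPT_unit_and_large_jobs_le:
  assumes "0 < d" "d \<le> m"
  shows "OPT m (replicate (d * q) 1 @ replicate (m - d) (real q)) \<le> real q"
proof -
  define s where "s = map (\<lambda>j. j mod d) [0..<d * q] @ [d..<m]"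
  let ?n = "d * q"
  let ?\<sigma> = "replicate ?n 1 @ replicate (m - d) (real q)"
  have small: "s ! j = j mod d" if "j < ?n" for j
    using that by (simp add: s_def nth_append)
  have large: "s ! j = d + (j - ?n)" if "j \<in> {?n..<?n + (m - d)}" for j
    using that by (auto simp: s_def nth_append intro: nth_upt[THEN trans])
  have "s \<in> schedules m ?\<sigma>"
    using assms by (auto simp: s_def schedules_def intro: less_le_trans[OF mod_less_divisor])
  then have "OPT m ?\<sigma> \<le> makespan m ?\<sigma> s" by (rule OPT_le)
  also have "\<dots> \<le> real q"
  proof (rule makespan_le)
    fix i assume "i < m"
    show "load ?\<sigma> s i \<le> real q"
    proof (cases "i < d")
      case True
      have "num_on ?n s i = card {j. j < ?n \<and> j mod d = i}"
        unfolding num_on_def by (intro arg_cong[where f = card]) (auto simp: small)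
      moreover have no_large: "{j \<in> {?n..<?n + (m - d)}. s ! j = i} = {}"
        using True large by force
      ultimately show ?thesis
        unfolding load_replicate_append no_large using card_mod_eq_le[of d q i] by simp
    next
      case False
      have "{j. j < ?n \<and> s ! j = i} = {}"
        using False assms by (auto simp: small)
      then have "num_on ?n s i = 0" by (simp add: num_on_def)
      \<comment> \<open>Machine \<open>i \<ge> d\<close> can receive only the large job at position
        \<open>?n + (i - d)\<close>.\<close>
      moreover have "card {j \<in> {?n..<?n + (m - d)}. s ! j = i} \<le> card {?n + (i - d)}"
        using large by (intro card_mono) auto
      ultimately show ?thesis
        by (simp add: load_replicate_append mult_left_le)
    qed
  qed (use assms in simp)
  finally show ?thesis .
qed

section \<open>Loads and thresholds\<close>

lemma ex_many_above_threshold: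
  fixes L :: "'a \<Rightarrow> real"
  assumes "finite S" "card S = m" "(\<Sum>i<m. t i) < sum L S"
  shows "\<exists>i<m. i < card {x \<in> S. t i < L x}"
  using assms
proof (induction m arbitrary: S)
  case 0
  then show ?case by simp
next
  case (Suc m)
  then have "S \<noteq> {}" by auto
  then obtain x where x: "x \<in> S" and min: "\<And>y. y \<in> S \<Longrightarrow> L x \<le> L y"
    using ex_min_if_finite[of "L ` S"] Suc.prems(1) by (auto simp: not_less)
  show ?case
  proof (cases "t m < L x")
    case True
    then have "{y \<in> S. t m < L y} = S" using min by force
    then show ?thesis using Suc.prems by auto
  next
    case False
    have "sum L S = L x + sum L (S - {x})"
      using Suc.prems(1) x by (simp add: sum.remove)
    then have "(\<Sum>i<m. t i) < sum L (S - {x})" using False Suc.prems(3) by simp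
    then obtain i where i: "i < m" "i < card {y \<in> S - {x}. t i < L y}"
      using Suc.IH[of "S - {x}"] Suc.prems x by auto
    have "card {y \<in> S - {x}. t i < L y} \<le> card {y \<in> S. t i < L y}"
      using Suc.prems(1) by (intro card_mono) auto
    then show ?thesis using i by (intro exI[of _ i]) auto
  qed
qed

text \<open>The left-hand side is strictly increasing in \<open>c\<close> and attains 1 at
  \<open>critical_ratio m\<close>.\<close>

lemma sum_thresholds_less:
  assumes "m \<ge> 2" "1 < c" "c < critical_ratio m"
  shows "(\<Sum>i=1..m-1. min (c / real m) ((c - 1) / real i)) + c / real m < 1"
proof -
  have "(\<Sum>i=1..m-1. min (c / real m) ((c - 1) / real i)) + c / real m
      < (\<Sum>i=1..m-1. min (critical_ratio m / real m) ((critical_ratio m - 1) / real i))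
        + critical_ratio m / real m"
    using assms
    by (intro add_le_less_mono sum_mono min.mono divide_right_mono divide_strict_right_mono) auto
  also have "\<dots> = critical_fun m (critical_ratio m)"
    using assms by (subst critical_fun_eq_sum_min) auto
  also have "\<dots> = 1" using assms(1) by (rule critical_ratio)
  finally show ?thesis .
qed

text \<open>For \<open>c \<ge> 2\<close> each threshold is at least \<open>1 / m\<close>, because
  \<open>i < m\<close>, so they would sum to at least 1. The bound is what rules out two large jobs
  on one machine.\<close>

lemma less_2_if_less_critical_ratio:
  assumes "m \<ge> 2" "1 < c" "c < critical_ratio m"
  shows "c < 2"
proof (rule ccontr)
  assume "\<not> c < 2"
  have "1 \<le> real (m - 1) * (1 / real m) + 2 / real m"
    using assms(1) by (simp add: of_nat_diff field_simps)
  also have "\<dots> = (\<Sum>i=1..m-1. 1 / real m) + 2 / real m"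
    by simp
  also have "\<dots> \<le> (\<Sum>i=1..m-1. min (c / real m) ((c - 1) / real i)) + c / real m"
    using \<open>\<not> c < 2\<close> assms(1)
    by (intro add_mono sum_mono min.boundedI divide_right_mono frac_le) auto
  finally show False using sum_thresholds_less[OF assms] by simp
qed

section \<open>The adversary's input and the contradiction\<close>

theorem theorem2:
  fixes m :: nat and A :: online_algorithm and g :: "nat \<Rightarrow> real"
  assumes "m \<ge> 2"
    and "valid_algorithm m A"
    and "g \<in> o(\<lambda>n. real n)"
    and "\<And>\<sigma>. job_sequence \<sigma> \<Longrightarrow> real (num_migrations A \<sigma>) \<le> g (length \<sigma>)"
  shows "\<forall>c<critical_ratio m. \<not> competitive m c A"
proof (intro allI impI notI)
  fix c0 assume "c0 < critical_ratio m" "competitive m c0 A"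
  \<comment> \<open>Taking the maximum with the midpoint of 1 and the critical ratio ensures
    \<open>c > 1\<close>.\<close>
  define c where "c = max c0 ((1 + critical_ratio m) / 2)"
  have c: "1 < c" "c < critical_ratio m"
    using \<open>c0 < critical_ratio m\<close> critical_ratio(1)[OF assms(1)]
    by (auto simp: c_def less_max_iff_disj)
  have comp: "competitive m c A"
    using assms(1) \<open>competitive m c0 A\<close> by (elim competitive_mono[rotated]) (auto simp: c_def)
  have c2: "c < 2" using less_2_if_less_critical_ratio assms(1) c .

  \<comment> \<open>The index 0 is separate because \<open>(c - 1) / 0 = 0\<close> would turn the
    minimum into 0.\<close>
  define t where "t i = (if i = 0 then c / m else min (c / m) ((c - 1) / i))" for i :: nat
  \<comment> \<open>Half of the slack, spread evenly over the \<open>m\<close> thresholds.\<close>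
  define \<delta> where "\<delta> = (1 - (\<Sum>i<m. t i)) / (2 * m)"
  have "{..<m} = insert 0 {1..m-1}" using assms(1) by auto
  then have "(\<Sum>i<m. t i) = (\<Sum>i=1..m-1. min (c / m) ((c - 1) / i)) + c / m"
    by (simp add: t_def)
  then have t_less: "(\<Sum>i<m. t i) < 1" using sum_thresholds_less[OF assms(1) c] by simp
  then have \<delta>: "\<delta> > 0" using assms(1) by (simp add: \<delta>_def)
  have "(\<Sum>i<m. t i + \<delta>) = (1 + (\<Sum>i<m. t i)) / 2"
    using assms(1) by (simp add: sum.distrib) (simp add: \<delta>_def field_simps)
  then have t\<delta>_less: "(\<Sum>i<m. t i + \<delta>) < 1" using t_less by simp

  \<comment> \<open>The factor 1/2 compensates for an input of up to \<open>2 * n\<close>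
    jobs.\<close>
  obtain N where N: "\<bar>g k\<bar> \<le> \<delta> / 2 * real k" if "k \<ge> N" for k
    using landau_o.smallD[OF assms(3), of "\<delta> / 2"] \<delta> by (auto simp: eventually_sequentially)
  \<comment> \<open>The factorial makes \<open>n\<close> divisible by every possible
    \<open>d\<close>; the other factor gives \<open>n \<ge> N\<close> for the migration bound and
    \<open>n \<ge> m\<close>, so that the large jobs at most double the length.\<close>
  define n where "n = fact m * (N + m + 1)"
  have n_ge: "N + m + 1 \<le> n"
    unfolding n_def using mult_le_mono1[OF fact_ge_1[of m], of "N + m + 1"] by simp
  have dvd_n: "d dvd n" if "0 < d" "d \<le> m" for d
    unfolding n_def using that by (intro dvd_mult2 dvd_fact) auto

  define \<sigma>\<^sub>0 where "\<sigma>\<^sub>0 = replicate n (1::real)"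
  define L where "L i = num_on n (online_schedule A \<sigma>\<^sub>0 n) i" for i
  have "job_sequence \<sigma>\<^sub>0" by (auto simp: job_sequence_def \<sigma>\<^sub>0_def)
  then have "(\<Sum>i<m. L i) = n"
    unfolding L_def using set_online_schedule[OF assms(2), of \<sigma>\<^sub>0 n]
    by (intro sum_num_on) (auto simp: \<sigma>\<^sub>0_def)
  then have "(\<Sum>i<m. real (L i)) = n" by (metis of_nat_sum)
  moreover have "(\<Sum>i<m. n * (t i + \<delta>)) < n"
    using t\<delta>_less n_ge by (simp flip: sum_distrib_left)
  ultimately obtain i where i: "i < m" "i < card {x \<in> {..<m}. n * (t i + \<delta>) < L x}"
    using ex_many_above_threshold[of "{..<m}" m "\<lambda>i. n * (t i + \<delta>)" L] by auto
  define H where "H = {x \<in> {..<m}. n * (t i + \<delta>) < L x}"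

  \<comment> \<open>The unit jobs can be spread evenly over \<open>d\<close> machines offline, each
    then having load \<open>q\<close>. The value \<open>d = m\<close> encodes that the input ends
    after the unit jobs.\<close>
  define d where "d = (if t i = c / m then m else i)"
  define q where "q = n div d"
  have d: "0 < d" "d \<le> m" using i assms(1) by (auto simp: d_def t_def split: if_splits)
  have n_eq: "n = d * q" using dvd_n[OF d] by (simp add: q_def)
  have q: "q > 0" using n_eq n_ge by (cases q) auto
  define \<sigma> where "\<sigma> = \<sigma>\<^sub>0 @ replicate (m - d) (real q)"
  define s where "s = final_schedule A \<sigma>"
  have \<sigma>: "job_sequence \<sigma>" using q by (auto simp: job_sequence_def \<sigma>_def \<sigma>\<^sub>0_def)
  have length_\<sigma>: "length \<sigma> = n + (m - d)" by (simp add: \<sigma>_def \<sigma>\<^sub>0_def)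
  have s: "length s = n + (m - d)" "set s \<subseteq> {..<m}"
    using final_schedule_in_schedules[OF assms(2) \<sigma>] by (auto simp: s_def schedules_def length_\<sigma>)
  have "makespan m \<sigma> s \<le> c * OPT m \<sigma>"
    using comp \<sigma> by (auto simp: competitive_def s_def)
  also have "\<dots> \<le> c * q"
    using OPT_unit_and_large_jobs_le[OF d, of q] c by (simp add: \<sigma>_def \<sigma>\<^sub>0_def flip: n_eq)
  finally have load_le: "load \<sigma> s x \<le> c * q" if "x < m" for x
    using load_le_makespan[OF that, of \<sigma> s] by simp

  have "real (num_migrations A \<sigma>) \<le> g (n + (m - d))"
    using assms(4)[OF \<sigma>] by (simp add: length_\<sigma>)
  also have "\<dots> \<le> \<delta> / 2 * real (n + (m - d))"
    using N[of "n + (m - d)"] n_ge by simp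
  also have "\<dots> \<le> \<delta> / 2 * real (2 * n)"
    using \<delta> n_ge by (intro mult_left_mono) auto
  finally have migrations_le: "real (num_migrations A \<sigma>) \<le> \<delta> * n" by simp
  \<comment> \<open>The surplus \<open>n * \<delta>\<close> in the definition of \<open>H\<close>
    pays for all unit jobs that are migrated away.\<close>
  have num_on_gt: "n * t i < num_on n s x" if "x \<in> H" for x
  proof -
    have "L x \<le> num_on n s x + num_migrations A \<sigma>"
      using num_on_final_schedule[of \<sigma>\<^sub>0] by (simp add: L_def s_def \<sigma>_def \<sigma>\<^sub>0_def)
    then have "real (L x) \<le> num_on n s x + real (num_migrations A \<sigma>)" by linarith
    moreover have "n * t i + n * \<delta> < L x" using that by (simp add: H_def algebra_simps)
    ultimately show ?thesis using migrations_le by (simp add: algebra_simps)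
  qed
  have load_eq: "load \<sigma> s x = num_on n s x + q * real (card {j \<in> {n..<n + (m - d)}. s ! j = x})"
    for x by (simp add: \<sigma>_def \<sigma>\<^sub>0_def load_replicate_append)

  show False
  proof (cases "t i = c / m")
    case True
    have "card H \<noteq> 0" using i(2) unfolding H_def by linarith
    then obtain x where x: "x \<in> H" by fastforce
    have "n * t i = c * q" using True n_eq assms(1) by (simp add: d_def)
    moreover have "load \<sigma> s x = num_on n s x" using True by (simp add: load_eq d_def)
    ultimately show False using num_on_gt[OF x] load_le[of x] x by (simp add: H_def)
  next
    case False
    then have "d = i" "t i = (c - 1) / i" "i > 0"
      by (auto simp: d_def t_def min_def split: if_splits)
    then have nt: "n * t i = (c - 1) * q" using n_eq by simp
    let ?J = "{n..<n + (m - d)}"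
    have J_less: "s ! j < m" if "j \<in> ?J" for j
    proof -
      have "j < length s" using that s(1) by simp
      then show ?thesis using s(2) nth_mem by blast
    qed
    show False
    proof (cases "\<exists>j\<in>?J. s ! j \<in> H")
      case True
      then obtain j where j: "j \<in> ?J" "s ! j \<in> H" by blast
      have "card {k \<in> ?J. s ! k = s ! j} \<ge> card {j}" using j by (intro card_mono) auto
      then have "real q * 1 \<le> q * real (card {k \<in> ?J. s ! k = s ! j})"
        by (intro mult_left_mono) auto
      \<comment> \<open>Unit jobs of total size above \<open>(c - 1) * q\<close> meet a large job of
        size \<open>q\<close>.\<close>
      then have "c * q < load \<sigma> s (s ! j)"
        using num_on_gt[OF j(2)] nt by (simp add: load_eq algebra_simps)
      then show False using load_le[OF J_less[OF j(1)]] by simp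
    next
      case False
      \<comment> \<open>Pigeonhole: \<open>card H > i\<close> leaves fewer than \<open>m - i\<close>
        machines for the \<open>m - i\<close> large jobs, all of which avoid
        \<open>H\<close>.\<close>
      have "card ({..<m} - H) = m - card H"
        by (subst card_Diff_subset) (auto simp: H_def)
      also have "\<dots> < card ?J" using i \<open>d = i\<close> by (simp add: H_def)
      finally have "\<not> inj_on ((!) s) ?J"
        using False J_less card_inj_on_le[of "(!) s" ?J "{..<m} - H"] by fastforce
      then obtain j k where jk: "j \<in> ?J" "k \<in> ?J" "j \<noteq> k" "s ! j = s ! k"
        by (auto simp: inj_on_def)
      have "card {l \<in> ?J. s ! l = s ! j} \<ge> card {j, k}" using jk by (intro card_mono) auto
      then have "real q * 2 \<le> q * real (card {l \<in> ?J. s ! l = s ! j})"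
        using jk(3) by (intro mult_left_mono) auto
      then have "2 * q \<le> load \<sigma> s (s ! j)" by (simp add: load_eq)
      moreover have "c * q < 2 * q" using c2 q by simp
      ultimately show False using load_le[OF J_less[OF jk(1)]] by simp
    qed
  qed
qed

end
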